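(* Let $a<b$ be real numbers and let $r$ be a positive continuous function on the interval $(a,b)$. Then for all measurable functions $f\ge 0$ on $(a,b)$ such that all integrals below exist and are finite, $$\int_a^b r(x)\left(\int_x^b f(t)\,dt\right)^2dx\le (b-a)\,\sup_{a<x<b}\left(\int_a^x r(t)\,dt\right)\int_a^b (f(x))^2\,dx.$$
   Context: Standing assumption: all functions are measurable and all the integrals appearing in the inequality (including $\int_a^x r$ and $\int_x^b f$ for $x\in(a,b)$) exist and are finite. The supremum is taken in $[0,+\infty]$, with $0\cdot\infty=0$. *)

theory Defs
  imports "HOL-Analysis.Analysis"
begin

end

theory Submission
  imports Defs
begin

text \<open>By Cauchy--Schwarz, \<open>(\<integral>\<^sub>x\<^sup>b f)\<^sup>2 \<le> (b - x) \<integral>\<^sub>a\<^sup>b f\<^sup>2\<close>. Bounding \<open>b - x\<close> by \<open>b - a\<close> and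
  integrating against \<open>r\<close> leaves the factor \<open>\<integral>\<^sub>a\<^sup>b r\<close>, which is the supremum of the
  integrals \<open>\<integral>\<^sub>a\<^sup>x r\<close> by monotone convergence.\<close>

text \<open>Continuity from below along a sequence increasing to \<open>b\<close>, which needs no
  finiteness. It is stated for a general measure so that it applies to the measure with density
  \<open>r\<close>.\<close>

lemma emeasure_greaterThanLessThan_eq_SUP:
  fixes a b :: real
  assumes "a < b" and sets: "\<And>x. {a<..<x} \<in> sets M"
  shows "emeasure M {a<..<b} = (SUP x\<in>{a<..<b}. emeasure M {a<..<x})"
proof (rule antisym)
  \<comment> \<open>The offset 2 in the denominator keeps \<open>y 0\<close> strictly above
    \<open>a\<close>; with offset 1 it would equal \<open>a\<close> and fall outside the index set
    of the supremum.\<close>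
  define y where "y n = b - (b - a) / real (Suc (Suc n))" for n
  have y_in: "y n \<in> {a<..<b}" for n
    using \<open>a < b\<close> mult_strict_right_mono[OF \<open>a < b\<close>, of "1 + real n"]
    by (auto simp: y_def field_simps)
  have y_mono: "y m \<le> y n" if "m \<le> n" for m n
    using that \<open>a < b\<close> by (auto simp: y_def intro!: divide_left_mono)
  have y_lim: "y \<longlonglongrightarrow> b"
    using tendsto_diff[OF tendsto_const[of b]
      tendsto_mult_left[OF LIMSEQ_Suc[OF LIMSEQ_inverse_real_of_nat], of "b - a"]]
    by (simp add: y_def[abs_def] divide_inverse)
  have inc: "incseq (\<lambda>n. {a<..<y n})"
    using y_mono by (fastforce simp: incseq_def)
  have "{a<..<b} = (\<Union>n. {a<..<y n})"
  proof (intro equalityI subsetI)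
    fix t assume t: "t \<in> {a<..<b}"
    then have "\<forall>\<^sub>F n in sequentially. t < y n"
      using order_tendstoD(1)[OF y_lim, of t] by auto
    then show "t \<in> (\<Union>n. {a<..<y n})"
      using t by (auto simp: eventually_sequentially)
  qed (use y_in in \<open>auto intro: less_trans\<close>)
  then have "emeasure M {a<..<b} = (SUP n. emeasure M {a<..<y n})"
    using SUP_emeasure_incseq[OF _ inc, of M] sets by (simp add: image_subset_iff)
  also have "\<dots> \<le> (SUP x\<in>{a<..<b}. emeasure M {a<..<x})"
    using y_in by (intro SUP_least SUP_upper)
  finally show "emeasure M {a<..<b} \<le> \<dots>" .
  show "(SUP x\<in>{a<..<b}. emeasure M {a<..<x}) \<le> emeasure M {a<..<b}"
    using sets by (intro SUP_least emeasure_mono) auto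
qed

text \<open>Cauchy--Schwarz against the constant 1, obtained from the nonnegativity of the variance
  of \<open>f\<close> on \<open>A\<close>.\<close>

lemma set_integral_square_le:
  fixes f :: "'a \<Rightarrow> real"
  assumes A: "A \<in> sets M" "emeasure M A < \<infinity>"
    and f: "set_integrable M A f" and f2: "set_integrable M A (\<lambda>x. (f x)\<^sup>2)"
  shows "(LINT x:A|M. f x)\<^sup>2 \<le> measure M A * (LINT x:A|M. (f x)\<^sup>2)"
proof (cases "measure M A = 0")
  case True
  \<comment> \<open>\<open>measure\<close> also returns 0 on sets of infinite
    \<open>emeasure\<close>; the finiteness assumption excludes that case.\<close>
  then have "A \<in> null_sets M"
    using A by (auto simp: measure_def null_sets_def enn2real_eq_0_iff)
  then have "(LINT x:A|M. f x) = 0"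
    unfolding set_lebesgue_integral_def
    by (intro integral_eq_zero_AE eventually_mono[OF AE_not_in]) auto
  then show ?thesis
    using True by simp
next
  case False
  define m where "m = measure M A"
  \<comment> \<open>The mean of \<open>f\<close> over \<open>A\<close>. With this choice the linear
    and constant terms of the expanded square combine to minus the squared integral of
    \<open>f\<close> divided by \<open>m\<close>.\<close>
  define c where "c = (LINT x:A|M. f x) / m"
  have m: "m > 0"
    using False by (simp add: m_def zero_less_measure_iff)
  have const: "set_integrable M A (\<lambda>x. k)" for k :: real
    using A by (simp add: set_integrable_def)
  have fc: "set_integrable M A (\<lambda>x. 2 * c * f x)"
    using f by simp
  have "0 \<le> (LINT x:A|M. (f x - c)\<^sup>2)"
    by (simp add: set_lebesgue_integral_def)
  also have "\<dots> = (LINT x:A|M. ((f x)\<^sup>2 - 2 * c * f x) + c\<^sup>2)"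
    by (simp add: power2_diff algebra_simps)
  also have "\<dots> = (LINT x:A|M. (f x)\<^sup>2) - 2 * c * (LINT x:A|M. f x) + m * c\<^sup>2"
    using f2 fc const A
    by (simp add: m_def set_lebesgue_integral_def[of M A "\<lambda>x. c\<^sup>2"])
  also have "\<dots> = (LINT x:A|M. (f x)\<^sup>2) - (LINT x:A|M. f x)\<^sup>2 / m"
    using m by (simp add: c_def field_simps power2_eq_square)
  finally show ?thesis
    using m by (simp add: m_def[symmetric] field_simps)
qed

theorem theorem2p4:
  fixes a b :: real and r f :: "real \<Rightarrow> real"
  assumes "a < b"
    and "continuous_on {a<..<b} r"
    and "\<And>x. x \<in> {a<..<b} \<Longrightarrow> r x > 0"
    and "set_borel_measurable lebesgue {a<..<b} f"
    and "\<And>x. x \<in> {a<..<b} \<Longrightarrow> f x \<ge> 0"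
    and "\<And>x. x \<in> {a<..<b} \<Longrightarrow> set_integrable lebesgue {a<..<x} r"
    and "\<And>x. x \<in> {a<..<b} \<Longrightarrow> set_integrable lebesgue {x<..<b} f"
    and "set_integrable lebesgue {a<..<b} (\<lambda>x. r x * (LINT t:{x<..<b}|lebesgue. f t)\<^sup>2)"
    and "set_integrable lebesgue {a<..<b} (\<lambda>x. (f x)\<^sup>2)"
  shows "ennreal (LINT x:{a<..<b}|lebesgue. r x * (LINT t:{x<..<b}|lebesgue. f t)\<^sup>2)
    \<le> ennreal (b - a) * (SUP x\<in>{a<..<b}. ennreal (LINT t:{a<..<x}|lebesgue. r t))
        * ennreal (LINT x:{a<..<b}|lebesgue. (f x)\<^sup>2)"
proof -
  define F where "F x = (LINT t:{x<..<b}|lebesgue. f t)" for x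
  define I where "I = (LINT x:{a<..<b}|lebesgue. (f x)\<^sup>2)"
  \<comment> \<open>\<open>r\<close> is controlled only inside the interval, so it is cut off to
    give a density on the whole line. Integrals of \<open>r\<close> then become values of the
    measure \<open>N\<close>, to which continuity from below applies.\<close>
  define \<rho> where "\<rho> t = ennreal (indicator {a<..<b} t * r t)" for t
  define N where "N = density lebesgue \<rho>"
  have r_nonneg: "r x \<ge> 0" if "x \<in> {a<..<b}" for x
    using assms(3)[OF that] by simp
  have I_nonneg: "I \<ge> 0"
    by (simp add: I_def set_lebesgue_integral_def)
  have "(\<lambda>t. indicator {a<..<b} t *\<^sub>R r t) \<in> borel_measurable borel"
    using assms(2) by (intro borel_measurable_continuous_on_indicator) auto
  then have "(\<lambda>t. indicator {a<..<b} t * r t) \<in> borel_measurable lebesgue"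
    by (simp add: measurable_completion)
  then have \<rho>_meas: "\<rho> \<in> borel_measurable lebesgue"
    by (simp add: \<rho>_def[abs_def])
  have N_eq: "emeasure N {a<..<x} = ennreal (LINT t:{a<..<x}|lebesgue. r t)"
    if x: "x \<in> {a<..<b}" for x
  proof -
    have "emeasure N {a<..<x} = (\<integral>\<^sup>+t. \<rho> t * indicator {a<..<x} t \<partial>lebesgue)"
      unfolding N_def using \<rho>_meas by (intro emeasure_density) auto
    also have "\<dots> = (\<integral>\<^sup>+t. ennreal (indicator {a<..<x} t *\<^sub>R r t) \<partial>lebesgue)"
      using x by (intro nn_integral_cong) (auto simp: \<rho>_def indicator_def)
    also have "\<dots> = ennreal (LINT t:{a<..<x}|lebesgue. r t)"
      unfolding set_lebesgue_integral_def
      using assms(6)[OF x] x r_nonneg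
      by (intro nn_integral_eq_integral) (auto simp: set_integrable_def indicator_def)
    finally show ?thesis .
  qed
  have F_le: "(F x)\<^sup>2 \<le> (b - a) * I" if x: "x \<in> {a<..<b}" for x
  proof -
    have sub: "set_integrable lebesgue {x<..<b} (\<lambda>x. (f x)\<^sup>2)"
      by (rule set_integrable_subset[OF assms(9)]) (use x in auto)
    have "(F x)\<^sup>2 \<le> (b - x) * (LINT t:{x<..<b}|lebesgue. (f t)\<^sup>2)"
      unfolding F_def
      using set_integral_square_le[OF _ _ assms(7)[OF x] sub] x by simp
    also have "\<dots> \<le> (b - a) * I"
    proof (rule mult_mono)
      show "(LINT t:{x<..<b}|lebesgue. (f t)\<^sup>2) \<le> I"
        unfolding I_def set_lebesgue_integral_def
        using sub assms(9) x
        by (intro integral_mono) (auto simp: set_integrable_def indicator_def)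
    qed (use x in \<open>auto simp: set_lebesgue_integral_def\<close>)
    finally show ?thesis .
  qed
  have "ennreal (LINT x:{a<..<b}|lebesgue. r x * (F x)\<^sup>2)
      = (\<integral>\<^sup>+x. ennreal (indicator {a<..<b} x *\<^sub>R (r x * (F x)\<^sup>2)) \<partial>lebesgue)"
    unfolding set_lebesgue_integral_def
    using assms(8) r_nonneg
    by (intro nn_integral_eq_integral[symmetric])
      (auto simp: set_integrable_def indicator_def F_def)
  \<comment> \<open>From here on the integrals are nonnegative extended ones, since the integral of
    \<open>r\<close> up to \<open>b\<close> may be infinite. The indicator already contained in
    \<open>\<rho>\<close> is repeated to match the form of \<open>emeasure_density\<close>.\<close>
  also have "\<dots> \<le> (\<integral>\<^sup>+x. ennreal ((b - a) * I) * (\<rho> x * indicator {a<..<b} x) \<partial>lebesgue)"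
  proof (rule nn_integral_mono)
    fix x
    show "ennreal (indicator {a<..<b} x *\<^sub>R (r x * (F x)\<^sup>2))
        \<le> ennreal ((b - a) * I) * (\<rho> x * indicator {a<..<b} x)"
    proof (cases "x \<in> {a<..<b}")
      case True
      then show ?thesis
        using F_le[OF True] r_nonneg[OF True] I_nonneg assms(1)
        by (auto simp: \<rho>_def ennreal_mult'[symmetric] mult.commute[of "r x"]
            intro!: ennreal_leI mult_right_mono)
    qed simp
  qed
  also have "\<dots> = ennreal ((b - a) * I) * emeasure N {a<..<b}"
    unfolding N_def using \<rho>_meas
    by (subst nn_integral_cmult)
      (auto simp: emeasure_density intro!: borel_measurable_times_ennreal borel_measurable_indicator)
  \<comment> \<open>Continuity from below for \<open>N\<close> at the right endpoint;
    \<open>N_eq\<close> turns each term of the supremum back into an integral of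
    \<open>r\<close>.\<close>
  also have "\<dots> = ennreal ((b - a) * I)
      * (SUP x\<in>{a<..<b}. ennreal (LINT t:{a<..<x}|lebesgue. r t))"
    using emeasure_greaterThanLessThan_eq_SUP[of a b N] assms(1) N_eq by (simp add: N_def)
  finally show ?thesis
    using assms(1) I_nonneg by (simp add: F_def I_def ennreal_mult ac_simps)
qed

end
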